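(* Let $M$ be a primitive substitution matrix and let $(V,E,r,s,d)$ be the Bratteli diagram defined by $M$. Let $N$ be another substitution matrix such that its associated Bratteli diagram $(V',E',r',s',d')$ is telescope equivalent to $(V,E,r,s,d)$. Then $N$ is also primitive.
   Context: A symbolic substitution on a finite nonempty alphabet $\mathcal L=\{l_1,\dots,l_n\}$ is a map $\sigma:\mathcal L\to\mathcal L^*$ into the finite words over $\mathcal L$. Its substitution matrix is the $n\times n$ non-negative integer matrix whose $(i,j)$-entry is the number of occurrences of $l_j$ in $\sigma(l_i)$. A non-negative square matrix is primitive if some power $M^k$, $k\in\mathbb N$, has all entries strictly positive. A (labelled) Bratteli diagram $(V,E,r,s,d)$ is an infinite directed graph with $V=\bigsqcup_{n\ge 0}V_n$, $E=\bigsqcup_{n\ge1}E_n$, all $V_n,E_n$ finite and nonempty, with $s(e)\in V_{n-1}$ and $r(e)\in V_n$ for $e\in E_n$; $s^{-1}(v)\ne\varnothing$ for all $v$, $r^{-1}(v)\neq\varnothing$ for all $v\notin V_0$; and a labelling $d:V\to\mathbb N$ with $d(v)=\sum_{r(e)=v}d(s(e))$ for $v\notin V_0$. The transition matrix from level $n-1$ to level $n$ has $(i,j)$-entry equal to the number of edges from the $i$-th vertex of $V_{n-1}$ to the $j$-th vertex of $V_n$. Two diagrams are isomorphic if there are bijections between their vertices and edges (level by level) preserving labels, range and source. Given a strictly increasing sequence $(m_n)_{n\ge0}$ of non-negative integers, the telescoping of the diagram has $V_n'=V_{m_n}$, $E_n'$ the set of paths from $V_{m_{n-1}}$ to $V_{m_n}$,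 with the induced range and source and restricted labelling; microscoping is the inverse operation. Two diagrams are telescope equivalent if one is obtained from the other by finitely many telescopings, microscopings and isomorphisms. The Bratteli diagram defined by (associated to) an $n\times n$ substitution matrix $M$ has $n$ vertices at every level, all labels equal to $1$ at level $0$, and every transition matrix equal to $M$ (it is understood that $M$ has no zero row or column, so that this is a Bratteli diagram). *)

theory Defs
  imports "HOL-Library.Disjoint_Sets" "HOL-Library.Countable_Set" "Jordan_Normal_Form.Matrix"
begin

section \<open>Substitutions and primitive matrices\<close>

text \<open>
  The alphabet is given by the list \<open>A\<close> of its letters \<open>l\<^sub>1, \<dots>, l\<^sub>n\<close>; the order of the letters
  matters only for the indexing of the matrix.  Matrix indices start at 0.
\<close>

definition symbolic_substitution :: "'a list \<Rightarrow> ('a \<Rightarrow> 'a list) \<Rightarrow> bool" where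
  "symbolic_substitution A \<sigma> \<longleftrightarrow>
     A \<noteq> [] \<and> distinct A \<and> (\<forall>a\<in>set A. \<sigma> a \<in> lists (set A))"

definition substitution_matrix :: "'a list \<Rightarrow> ('a \<Rightarrow> 'a list) \<Rightarrow> nat mat" where
  "substitution_matrix A \<sigma> =
     mat (length A) (length A) (\<lambda>(i, j). count_list (\<sigma> (A ! i)) (A ! j))"

text \<open>The exponent is at least 1; with exponent 0 the \<open>1 \<times> 1\<close> zero matrix would be primitive.\<close>

definition primitive_mat :: "nat mat \<Rightarrow> bool" where
  "primitive_mat M \<longleftrightarrow>
     square_mat M \<and>
     (\<exists>k\<ge>1. \<forall>i<dim_row M. \<forall>j<dim_col M. 0 < (M ^\<^sub>m k) $$ (i, j))"


section \<open>Labelled Bratteli diagrams\<close>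

text \<open>
  \<open>edges D n\<close> is the set \<open>E\<^sub>n\<close> of edges from level \<open>n - 1\<close> to level \<open>n\<close>, for \<open>n \<ge> 1\<close>; the value
  \<open>edges D 0\<close> is never used.  Labels are positive natural numbers.
\<close>

record ('v, 'e) diagram =
  vertices :: "nat \<Rightarrow> 'v set"
  edges :: "nat \<Rightarrow> 'e set"
  src :: "'e \<Rightarrow> 'v"
  rng :: "'e \<Rightarrow> 'v"
  label :: "'v \<Rightarrow> nat"

locale bratteli_diagram =
  fixes D :: "('v, 'e) diagram"
  assumes disjoint_vertices: "disjoint_family (vertices D)"
    and disjoint_edges: "disjoint_family_on (edges D) {1..}"
    and finite_vertices: "finite (vertices D n)"
    and vertices_nonempty: "vertices D n \<noteq> {}"
    and finite_edges: "finite (edges D (Suc n))"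
    and edges_nonempty: "edges D (Suc n) \<noteq> {}"
    and src_in: "e \<in> edges D (Suc n) \<Longrightarrow> src D e \<in> vertices D n"
    and rng_in: "e \<in> edges D (Suc n) \<Longrightarrow> rng D e \<in> vertices D (Suc n)"
    and out_edge: "v \<in> vertices D n \<Longrightarrow> \<exists>e\<in>edges D (Suc n). src D e = v"
    and in_edge: "v \<in> vertices D (Suc n) \<Longrightarrow> \<exists>e\<in>edges D (Suc n). rng D e = v"
    and label_pos: "v \<in> vertices D n \<Longrightarrow> 0 < label D v"
    and label_sum: "v \<in> vertices D (Suc n) \<Longrightarrow>
          label D v = (\<Sum>e | e \<in> edges D (Suc n) \<and> rng D e = v. label D (src D e))"

definition isomorphic :: "('v, 'e) diagram \<Rightarrow> ('w, 'f) diagram \<Rightarrow> bool" where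
  "isomorphic D D' \<longleftrightarrow>
     (\<exists>f g. (\<forall>n. bij_betw f (vertices D n) (vertices D' n)) \<and>
            (\<forall>n. bij_betw g (edges D (Suc n)) (edges D' (Suc n))) \<and>
            (\<forall>n. \<forall>v\<in>vertices D n. label D' (f v) = label D v) \<and>
            (\<forall>n. \<forall>e\<in>edges D (Suc n). src D' (g e) = f (src D e) \<and> rng D' (g e) = f (rng D e)))"

definition paths :: "('v, 'e) diagram \<Rightarrow> nat \<Rightarrow> nat \<Rightarrow> 'e list set" where
  "paths D k l =
     {p. length p = l - k \<and> (\<forall>i<length p. p ! i \<in> edges D (Suc (k + i))) \<and>
         (\<forall>i. Suc i < length p \<longrightarrow> rng D (p ! i) = src D (p ! Suc i))}"

definition telescope :: "(nat \<Rightarrow> nat) \<Rightarrow> ('v, 'e) diagram \<Rightarrow> ('v, 'e list) diagram" where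
  "telescope m D =
     \<lparr> vertices = (\<lambda>n. vertices D (m n)),
       edges = (\<lambda>n. if n = 0 then {} else paths D (m (n - 1)) (m n)),
       src = (\<lambda>p. src D (hd p)),
       rng = (\<lambda>p. rng D (last p)),
       label = label D \<rparr>"

text \<open>Note that \<open>m 0\<close> may be positive.\<close>

definition is_telescoping :: "('v, 'e) diagram \<Rightarrow> ('w, 'f) diagram \<Rightarrow> bool" where
  "is_telescoping D D' \<longleftrightarrow> (\<exists>m. strict_mono m \<and> isomorphic (telescope m D) D')"

text \<open>
  Telescoping changes the type of edges, so the intermediate diagrams in a telescope equivalence
  are taken, up to isomorphism, on the carrier type \<^typ>\<open>nat\<close>.  This is no restriction: every
  Bratteli diagram is countable, see \<open>isomorphic_to_nat_diagram\<close> below.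
  Telescope equivalence requires both diagrams to be Bratteli diagrams; for the diagram of a
  matrix this means that the matrix has no zero row or column, see
  \<open>bratteli_diagram_matrix_diagram_iff\<close>.
  The second disjunct in \<open>telescope_step\<close> is a telescoping, the third a microscoping.
\<close>

definition telescope_step :: "(nat, nat) diagram \<Rightarrow> (nat, nat) diagram \<Rightarrow> bool" where
  "telescope_step D D' \<longleftrightarrow> bratteli_diagram D \<and> bratteli_diagram D' \<and>
     (isomorphic D D' \<or> is_telescoping D D' \<or> is_telescoping D' D)"

definition telescope_equivalent :: "('v, 'e) diagram \<Rightarrow> ('w, 'f) diagram \<Rightarrow> bool" where
  "telescope_equivalent D D' \<longleftrightarrow> bratteli_diagram D \<and> bratteli_diagram D' \<and>
     (\<exists>C C'. isomorphic D C \<and> telescope_step\<^sup>*\<^sup>* C C' \<and> isomorphic C' D')"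


section \<open>The diagram defined by a square matrix\<close>

text \<open>
  The vertex \<open>(k, i)\<close> is the \<open>i\<close>-th vertex of level \<open>k\<close>, and \<open>(k, i, j, c)\<close> is the \<open>c\<close>-th edge
  from \<open>(k - 1, i)\<close> to \<open>(k, j)\<close>.  The labels are forced by the labels 1 at level 0.
\<close>

fun matrix_label :: "nat mat \<Rightarrow> nat \<times> nat \<Rightarrow> nat" where
  "matrix_label M (0, j) = 1"
| "matrix_label M (Suc k, j) = (\<Sum>i<dim_row M. M $$ (i, j) * matrix_label M (k, i))"

definition matrix_diagram :: "nat mat \<Rightarrow> (nat \<times> nat, nat \<times> nat \<times> nat \<times> nat) diagram" where
  "matrix_diagram M =
     \<lparr> vertices = (\<lambda>k. {(k, i) | i. i < dim_row M}),
       edges = (\<lambda>k. {(k, i, j, c) | i j c. i < dim_row M \<and> j < dim_row M \<and> c < M $$ (i, j)}),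
       src = (\<lambda>(k, i, j, c). (k - 1, i)),
       rng = (\<lambda>(k, i, j, c). (k, j)),
       label = matrix_label M \<rparr>"


section \<open>Basic facts\<close>

lemma transition_matrix_matrix_diagram:
  assumes "i < dim_row M" "j < dim_row M"
  shows "card {e \<in> edges (matrix_diagram M) (Suc k).
                 src (matrix_diagram M) e = (k, i) \<and> rng (matrix_diagram M) e = (Suc k, j)}
         = M $$ (i, j)"
proof -
  have "{e \<in> edges (matrix_diagram M) (Suc k).
            src (matrix_diagram M) e = (k, i) \<and> rng (matrix_diagram M) e = (Suc k, j)}
        = (\<lambda>c. (Suc k, i, j, c)) ` {..<M $$ (i, j)}"
    using assms by (auto simp: matrix_diagram_def)
  then show ?thesis by (simp add: card_image inj_on_def)
qed

lemma bratteli_diagram_matrix_diagram_iff: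
  assumes "M \<in> carrier_mat n n" "0 < n"
  shows "bratteli_diagram (matrix_diagram M) \<longleftrightarrow>
           (\<forall>i<n. \<exists>j<n. M $$ (i, j) \<noteq> 0) \<and> (\<forall>j<n. \<exists>i<n. M $$ (i, j) \<noteq> 0)"
proof
  let ?D = "matrix_diagram M"
  have [simp]: "dim_row M = n" using assms by auto
  show "(\<forall>i<n. \<exists>j<n. M $$ (i, j) \<noteq> 0) \<and> (\<forall>j<n. \<exists>i<n. M $$ (i, j) \<noteq> 0)"
    if "bratteli_diagram ?D"
  proof -
    interpret bratteli_diagram ?D by fact
    show ?thesis
    proof (intro conjI allI impI)
      fix i assume "i < n"
      then show "\<exists>j<n. M $$ (i, j) \<noteq> 0"
        using out_edge[of "(0, i)" 0] by (force simp: matrix_diagram_def)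
    next
      fix j assume "j < n"
      then show "\<exists>i<n. M $$ (i, j) \<noteq> 0"
        using in_edge[of "(1, j)" 0] by (force simp: matrix_diagram_def)
    qed
  qed
  assume *: "(\<forall>i<n. \<exists>j<n. M $$ (i, j) \<noteq> 0) \<and> (\<forall>j<n. \<exists>i<n. M $$ (i, j) \<noteq> 0)"
  have pos: "0 < matrix_label M (k, i)" if "i < n" for k i
    using that
  proof (induction k arbitrary: i)
    case (Suc k)
    obtain j where j: "j < n" "M $$ (j, i) \<noteq> 0" using * Suc.prems by blast
    then have "0 < M $$ (j, i) * matrix_label M (k, j)" using Suc.IH by simp
    also have "\<dots> \<le> (\<Sum>j<n. M $$ (j, i) * matrix_label M (k, j))"
      by (rule member_le_sum) (use j in auto)
    finally show ?case by simp
  qed simp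
  have fin: "finite {(k, i, j, c) | i j c. i < n \<and> j < n \<and> c < M $$ (i, j)}" for k
  proof -
    have "{(k, i, j, c) | i j c. i < n \<and> j < n \<and> c < M $$ (i, j)} =
      (\<Union>i<n. \<Union>j<n. (\<lambda>c. (k, i, j, c)) ` {..<M $$ (i, j)})" by auto
    then show ?thesis by simp
  qed
  have lab: "matrix_label M (Suc k, j) =
      (\<Sum>e | e \<in> edges ?D (Suc k) \<and> rng ?D e = (Suc k, j). label ?D (src ?D e))"
    if "j < n" for k j
  proof -
    have "{e. e \<in> edges ?D (Suc k) \<and> rng ?D e = (Suc k, j)} =
        (\<lambda>(i, c). (Suc k, i, j, c)) ` (SIGMA i:{..<n}. {..<M $$ (i, j)})"
      using that by (auto simp: matrix_diagram_def image_iff)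
    then have "(\<Sum>e | e \<in> edges ?D (Suc k) \<and> rng ?D e = (Suc k, j). label ?D (src ?D e)) =
        (\<Sum>(i, c)\<in>(SIGMA i:{..<n}. {..<M $$ (i, j)}). matrix_label M (k, i))"
      by (simp add: sum.reindex inj_on_def case_prod_beta matrix_diagram_def)
    also have "\<dots> = (\<Sum>i<n. \<Sum>c<M $$ (i, j). matrix_label M (k, i))"
      by (subst sum.Sigma) auto
    finally show ?thesis by simp
  qed
  show "bratteli_diagram ?D"
  proof
    show "disjoint_family (vertices ?D)" "disjoint_family_on (edges ?D) {1..}"
      by (auto simp: disjoint_family_on_def matrix_diagram_def)
    fix k
    have "vertices ?D k = (\<lambda>i. (k, i)) ` {..<n}" by (auto simp: matrix_diagram_def)
    then show "finite (vertices ?D k)" "vertices ?D k \<noteq> {}" using assms by auto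
    show "finite (edges ?D (Suc k))" using fin by (simp add: matrix_diagram_def)
    obtain j where "j < n" "0 < M $$ (0, j)" using * assms by (metis gr0I)
    then have "(Suc k, 0, j, 0) \<in> edges ?D (Suc k)" using assms by (simp add: matrix_diagram_def)
    then show "edges ?D (Suc k) \<noteq> {}" by blast
    show "src ?D e \<in> vertices ?D k" "rng ?D e \<in> vertices ?D (Suc k)"
      if "e \<in> edges ?D (Suc k)" for e
      using that by (auto simp: matrix_diagram_def)
    show "\<exists>e\<in>edges ?D (Suc k). src ?D e = v" if "v \<in> vertices ?D k" for v
    proof -
      from that obtain i where i: "v = (k, i)" "i < n" by (auto simp: matrix_diagram_def)
      then obtain j where "j < n" "0 < M $$ (i, j)" using * by (metis gr0I)
      with i show ?thesis
        by (intro bexI[of _ "(Suc k, i, j, 0)"]) (auto simp: matrix_diagram_def)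
    qed
    show "\<exists>e\<in>edges ?D (Suc k). rng ?D e = v" if "v \<in> vertices ?D (Suc k)" for v
    proof -
      from that obtain j where j: "v = (Suc k, j)" "j < n" by (auto simp: matrix_diagram_def)
      then obtain i where "i < n" "0 < M $$ (i, j)" using * by (metis gr0I)
      with j show ?thesis
        by (intro bexI[of _ "(Suc k, i, j, 0)"]) (auto simp: matrix_diagram_def)
    qed
    show "0 < label ?D v" if "v \<in> vertices ?D k" for v
      using that pos by (auto simp: matrix_diagram_def)
    show "label ?D v = (\<Sum>e | e \<in> edges ?D (Suc k) \<and> rng ?D e = v. label ?D (src ?D e))"
      if "v \<in> vertices ?D (Suc k)" for v
    proof -
      from that obtain j where "v = (Suc k, j)" "j < n" by (auto simp: matrix_diagram_def)
      then show ?thesis using lab[of j k] by (simp add: matrix_diagram_def)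
    qed
  qed
qed

lemma paths_Suc_0: "paths D k (Suc k) = (\<lambda>e. [e]) ` edges D (Suc k)"
  by (auto simp: paths_def length_Suc_conv)

lemma in_paths_iff:
  "p \<in> paths D k (k + j) \<longleftrightarrow>
     length p = j \<and> (\<forall>i<j. p ! i \<in> edges D (Suc (k + i))) \<and>
     (\<forall>i. Suc i < j \<longrightarrow> rng D (p ! i) = src D (p ! Suc i))"
  unfolding paths_def mem_Collect_eq add_diff_cancel_left' by metis

lemma snoc_in_paths_iff:
  "q @ [e] \<in> paths D k (Suc (k + Suc j)) \<longleftrightarrow>
     q \<in> paths D k (k + Suc j) \<and> e \<in> edges D (Suc (k + Suc j)) \<and> rng D (last q) = src D e"
proof -
  have "q @ [e] \<in> paths D k (k + Suc (Suc j)) \<longleftrightarrow>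
      q \<in> paths D k (k + Suc j) \<and> e \<in> edges D (Suc (k + Suc j)) \<and> rng D (last q) = src D e"
  proof (cases "length q = Suc j")
    case True
    then have last: "last q = q ! j" by (metis Zero_not_Suc diff_Suc_1 last_conv_nth list.size(3))
    have 1: "(\<forall>i<Suc (Suc j). (q @ [e]) ! i \<in> edges D (Suc (k + i))) \<longleftrightarrow>
        (\<forall>i<Suc j. q ! i \<in> edges D (Suc (k + i))) \<and> e \<in> edges D (Suc (k + Suc j))"
      unfolding All_less_Suc[of "Suc j"] using True by (auto simp: nth_append)
    have 2: "(\<forall>i. Suc i < Suc (Suc j) \<longrightarrow> rng D ((q @ [e]) ! i) = src D ((q @ [e]) ! Suc i)) \<longleftrightarrow>
        (\<forall>i. Suc i < Suc j \<longrightarrow> rng D (q ! i) = src D (q ! Suc i)) \<and> rng D (q ! j) = src D e"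
      unfolding Suc_less_eq All_less_Suc using True by (auto simp: nth_append)
    show ?thesis unfolding in_paths_iff 1 2 last using True by auto
  next
    case False
    then show ?thesis by (simp only: in_paths_iff) simp
  qed
  then show ?thesis by simp
qed

lemma paths_Suc:
  "paths D k (Suc (k + Suc j)) =
     (\<lambda>(e, q). q @ [e]) ` (SIGMA e:edges D (Suc (k + Suc j)).
       {q \<in> paths D k (k + Suc j). rng D (last q) = src D e})"
proof -
  have "p \<noteq> []" if "p \<in> paths D k (Suc (k + Suc j))" for p
    using that by (auto simp: paths_def)
  then have "\<exists>q e. p = q @ [e]" if "p \<in> paths D k (Suc (k + Suc j))" for p
    using that by (meson rev_exhaust)
  note ex = this
  show ?thesis
  proof (intro equalityI subsetI)
    fix p assume p: "p \<in> paths D k (Suc (k + Suc j))"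
    then obtain q e where pq: "p = q @ [e]" using ex by blast
    have "(e, q) \<in> (SIGMA e:edges D (Suc (k + Suc j)).
        {q \<in> paths D k (k + Suc j). rng D (last q) = src D e})"
      using p unfolding pq snoc_in_paths_iff by blast
    then show "p \<in> (\<lambda>(e, q). q @ [e]) ` (SIGMA e:edges D (Suc (k + Suc j)).
        {q \<in> paths D k (k + Suc j). rng D (last q) = src D e})"
      by (rule rev_image_eqI) (simp add: pq)
  next
    fix p assume "p \<in> (\<lambda>(e, q). q @ [e]) ` (SIGMA e:edges D (Suc (k + Suc j)).
        {q \<in> paths D k (k + Suc j). rng D (last q) = src D e})"
    then obtain q e where "p = q @ [e]" "e \<in> edges D (Suc (k + Suc j))"
      "q \<in> paths D k (k + Suc j)" "rng D (last q) = src D e"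
      by (auto simp del: add_Suc_right)
    then show "p \<in> paths D k (Suc (k + Suc j))"
      by (simp add: snoc_in_paths_iff del: add_Suc_right)
  qed
qed

lemma paths_nonempty_list: "p \<in> paths D k (k + Suc j) \<Longrightarrow> p \<noteq> []"
  by (auto simp: paths_def)

lemma hd_in_edges:
  assumes "p \<in> paths D k (k + Suc j)"
  shows "hd p \<in> edges D (Suc k)"
proof -
  have "p ! 0 \<in> edges D (Suc (k + 0))" using assms
    unfolding paths_def mem_Collect_eq by (metis add_Suc_right diff_add_inverse zero_less_Suc)
  then show ?thesis using paths_nonempty_list[OF assms] by (simp add: hd_conv_nth)
qed

lemma (in bratteli_diagram) paths_facts:
  "finite (paths D k (k + Suc j))"
  "\<forall>p\<in>paths D k (k + Suc j). rng D (last p) \<in> vertices D (k + Suc j)"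
  "\<forall>v\<in>vertices D k. \<exists>p\<in>paths D k (k + Suc j). src D (hd p) = v"
  "\<forall>v\<in>vertices D (k + Suc j). \<exists>p\<in>paths D k (k + Suc j). rng D (last p) = v"
  "\<forall>v\<in>vertices D (k + Suc j). label D v =
     (\<Sum>p | p \<in> paths D k (k + Suc j) \<and> rng D (last p) = v. label D (src D (hd p)))"
proof (induction j)
  case 0
  {
    case 1 show ?case by (simp add: paths_Suc_0 finite_edges)
  next
    case 2 show ?case by (simp add: paths_Suc_0 rng_in)
  next
    case 3 show ?case using out_edge by (simp add: paths_Suc_0)
  next
    case 4 show ?case using in_edge by (simp add: paths_Suc_0)
  next
    case 5
    have "{p. p \<in> paths D k (Suc k) \<and> rng D (last p) = v} =
        (\<lambda>e. [e]) ` {e. e \<in> edges D (Suc k) \<and> rng D e = v}" for v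
      by (auto simp: paths_Suc_0)
    then have "(\<Sum>p | p \<in> paths D k (Suc k) \<and> rng D (last p) = v. label D (src D (hd p))) =
        (\<Sum>e | e \<in> edges D (Suc k) \<and> rng D e = v. label D (src D e))" for v
      by (simp add: sum.reindex inj_on_def)
    then show ?case by (auto intro: label_sum[of _ k, THEN trans])
  }
next
  case (Suc j)
  let ?l = "k + Suc j"
  have P: "paths D k (k + Suc (Suc j)) = paths D k (Suc ?l)" by simp
  {
    case 1 show ?case unfolding P paths_Suc
      by (intro finite_imageI finite_SigmaI finite_edges) (use Suc.IH(1) in simp)
  next
    case 2 show ?case unfolding P paths_Suc using rng_in[of _ ?l] by auto
  next
    case 3 show ?case
    proof
      fix v assume "v \<in> vertices D k"
      then obtain p where p: "p \<in> paths D k ?l" "src D (hd p) = v" using Suc.IH(3) by blast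
      moreover obtain e where "e \<in> edges D (Suc ?l)" "src D e = rng D (last p)"
        using Suc.IH(2) p(1) out_edge by metis
      ultimately have "p @ [e] \<in> paths D k (Suc ?l)" "src D (hd (p @ [e])) = v"
        using paths_nonempty_list[OF p(1)] p by (auto simp: snoc_in_paths_iff simp del: add_Suc_right)
      then show "\<exists>p\<in>paths D k (k + Suc (Suc j)). src D (hd p) = v" unfolding P by blast
    qed
  next
    case 4 show ?case
    proof
      fix v assume "v \<in> vertices D (k + Suc (Suc j))"
      then obtain e where e: "e \<in> edges D (Suc ?l)" "rng D e = v" using in_edge[of v ?l] by auto
      moreover obtain p where "p \<in> paths D k ?l" "rng D (last p) = src D e"
        using Suc.IH(4) src_in[OF e(1)] by blast
      ultimately have "p @ [e] \<in> paths D k (Suc ?l)" "rng D (last (p @ [e])) = v"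
        by (auto simp: snoc_in_paths_iff simp del: add_Suc_right)
      then show "\<exists>p\<in>paths D k (k + Suc (Suc j)). rng D (last p) = v" unfolding P by blast
    qed
  next
    case 5 show ?case
    proof
      fix v assume v: "v \<in> vertices D (k + Suc (Suc j))"
      let ?E = "{e. e \<in> edges D (Suc ?l) \<and> rng D e = v}"
      let ?Q = "\<lambda>e. {q. q \<in> paths D k ?l \<and> rng D (last q) = src D e}"
      have "{p. p \<in> paths D k (k + Suc (Suc j)) \<and> rng D (last p) = v} =
          (\<lambda>(e, q). q @ [e]) ` Sigma ?E ?Q"
        unfolding P paths_Suc by auto
      then have "(\<Sum>p | p \<in> paths D k (k + Suc (Suc j)) \<and> rng D (last p) = v.
            label D (src D (hd p))) =
          (\<Sum>(e, q)\<in>Sigma ?E ?Q. label D (src D (hd (q @ [e]))))"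
        by (simp add: sum.reindex inj_on_def case_prod_beta)
      also have "\<dots> = (\<Sum>e\<in>?E. \<Sum>q\<in>?Q e. label D (src D (hd (q @ [e]))))"
        by (subst sum.Sigma) (use finite_edges[of ?l] Suc.IH(1) in auto)
      also have "\<dots> = (\<Sum>e\<in>?E. \<Sum>q\<in>?Q e. label D (src D (hd q)))"
        by (intro sum.cong refl) (use paths_nonempty_list[of _ D k j] in auto)
      also have "\<dots> = (\<Sum>e\<in>?E. label D (src D e))"
      proof (rule sum.cong[OF refl])
        fix e assume "e \<in> ?E"
        then have "src D e \<in> vertices D ?l" using src_in by blast
        then show "(\<Sum>q\<in>?Q e. label D (src D (hd q))) = label D (src D e)"
          by (rule Suc.IH(5)[rule_format, symmetric])
      qed
      also have "\<dots> = label D v" by (rule label_sum[symmetric]) (use v in simp)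
      finally show "label D v = (\<Sum>p | p \<in> paths D k (k + Suc (Suc j)) \<and> rng D (last p) = v.
            label D (src D (hd p)))" by simp
    qed
  }
qed

lemma (in bratteli_diagram) bratteli_diagram_telescope:
  assumes "strict_mono m"
  shows "bratteli_diagram (telescope m D)"
proof -
  let ?T = "telescope m D"
  have T: "vertices ?T n = vertices D (m n)" "edges ?T (Suc n) = paths D (m n) (m (Suc n))"
    "src ?T p = src D (hd p)" "rng ?T p = rng D (last p)" "label ?T v = label D v" for n p v
    by (simp_all add: telescope_def)
  have step: "\<exists>j. m (Suc n) = m n + Suc j" for n
    using strict_monoD[OF assms, of n "Suc n"] less_imp_Suc_add by fastforce
  have hd: "hd p \<in> edges D (Suc (m n))" if "p \<in> edges ?T (Suc n)" for p n
    using that step[of n] hd_in_edges by (auto simp: T)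
  show ?thesis
  proof
    show "disjoint_family (vertices ?T)"
      using disjoint_vertices strict_mono_eq[OF assms] by (auto simp: disjoint_family_on_def T)
    show "disjoint_family_on (edges ?T) {1..}"
      unfolding disjoint_family_on_def
    proof (intro ballI impI)
      fix a b :: nat assume "a \<in> {1..}" "b \<in> {1..}" "a \<noteq> b"
      then obtain a' b' where ab: "a = Suc a'" "b = Suc b'" "a' \<noteq> b'"
        by (cases a; cases b) auto
      then have "edges D (Suc (m a')) \<inter> edges D (Suc (m b')) = {}"
        using disjoint_edges strict_mono_eq[OF assms] by (simp add: disjoint_family_on_def)
      then show "edges ?T a \<inter> edges ?T b = {}" using hd ab by blast
    qed
    fix n
    obtain j where j: "m (Suc n) = m n + Suc j" using step by blast
    note facts = paths_facts[of "m n" j, folded j]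
    show "finite (vertices ?T n)" "vertices ?T n \<noteq> {}"
      by (simp_all add: T finite_vertices vertices_nonempty)
    show "finite (edges ?T (Suc n))" using facts(1) by (simp add: T)
    show "edges ?T (Suc n) \<noteq> {}" using facts(3) vertices_nonempty[of "m n"] by (auto simp: T)
    show "src ?T e \<in> vertices ?T n" if "e \<in> edges ?T (Suc n)" for e
      using src_in[OF hd[OF that]] by (simp add: T)
    show "rng ?T e \<in> vertices ?T (Suc n)" if "e \<in> edges ?T (Suc n)" for e
      using that facts(2) by (simp add: T)
    show "\<exists>e\<in>edges ?T (Suc n). src ?T e = v" if "v \<in> vertices ?T n" for v
      using that facts(3) by (simp add: T)
    show "\<exists>e\<in>edges ?T (Suc n). rng ?T e = v" if "v \<in> vertices ?T (Suc n)" for v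
      using that facts(4) by (simp add: T)
    show "0 < label ?T v" if "v \<in> vertices ?T n" for v
      using that label_pos by (simp add: T)
    show "label ?T v = (\<Sum>e | e \<in> edges ?T (Suc n) \<and> rng ?T e = v. label ?T (src ?T e))"
      if "v \<in> vertices ?T (Suc n)" for v
      unfolding T by (rule facts(5)[rule_format]) (use that in \<open>simp add: T\<close>)
  qed
qed

lemma isomorphic_to_nat_diagram:
  fixes D :: "('v, 'e) diagram"
  assumes "bratteli_diagram D"
  shows "\<exists>C :: (nat, nat) diagram. bratteli_diagram C \<and> isomorphic D C"
proof -
  interpret bratteli_diagram D by fact
  define V where "V = (\<Union>n. vertices D n)"
  define E where "E = (\<Union>n. edges D (Suc n))"
  have "countable V" "countable E"
    unfolding V_def E_def by (auto intro: countable_finite finite_vertices finite_edges)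
  then obtain f :: "'v \<Rightarrow> nat" and g :: "'e \<Rightarrow> nat" where f: "inj_on f V" and g: "inj_on g E"
    by (auto elim!: countableE)
  have VV: "v \<in> V" if "v \<in> vertices D n" for v n using that by (auto simp: V_def)
  have EE: "e \<in> E" if "e \<in> edges D (Suc n)" for e n using that by (auto simp: E_def)
  define C :: "(nat, nat) diagram" where "C =
    \<lparr> vertices = (\<lambda>n. f ` vertices D n), edges = (\<lambda>n. g ` edges D n),
      src = f \<circ> src D \<circ> inv_into E g, rng = f \<circ> rng D \<circ> inv_into E g,
      label = label D \<circ> inv_into V f \<rparr>"
  have C: "vertices C n = f ` vertices D n" "edges C n = g ` edges D n"
    "v \<in> V \<Longrightarrow> label C (f v) = label D v"
    "e \<in> E \<Longrightarrow> src C (g e) = f (src D e)" "e \<in> E \<Longrightarrow> rng C (g e) = f (rng D e)"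
    for n v e using f g by (auto simp: C_def)
  have iso: "isomorphic D C"
    unfolding isomorphic_def
  proof (rule exI[of _ f], rule exI[of _ g], intro conjI allI ballI)
    fix n
    show "bij_betw f (vertices D n) (vertices C n)"
      unfolding C by (intro inj_on_imp_bij_betw inj_on_subset[OF f]) (auto simp: V_def)
    show "bij_betw g (edges D (Suc n)) (edges C (Suc n))"
      unfolding C by (intro inj_on_imp_bij_betw inj_on_subset[OF g]) (auto simp: E_def)
  qed (use VV EE C in auto)
  have "bratteli_diagram C"
  proof
    show "disjoint_family (vertices C)"
      unfolding disjoint_family_on_def
    proof (intro ballI impI)
      fix a b :: nat assume "a \<noteq> b"
      then have "vertices D a \<inter> vertices D b = {}"
        using disjoint_vertices by (auto simp: disjoint_family_on_def)
      then show "vertices C a \<inter> vertices C b = {}"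
        using inj_on_image_Int[OF f, of "vertices D a" "vertices D b"] VV by (auto simp: C)
    qed
    show "disjoint_family_on (edges C) {1..}"
      unfolding disjoint_family_on_def
    proof (intro ballI impI)
      fix a b :: nat assume *: "a \<in> {1..}" "b \<in> {1..}" "a \<noteq> b"
      then have "edges D a \<inter> edges D b = {}"
        using disjoint_edges by (auto simp: disjoint_family_on_def)
      moreover have "edges D a \<subseteq> E" "edges D b \<subseteq> E"
        using * EE[of _ "a - 1"] EE[of _ "b - 1"] by auto
      ultimately show "edges C a \<inter> edges C b = {}"
        using inj_on_image_Int[OF g, of "edges D a" "edges D b"] by (auto simp: C)
    qed
    fix n
    show "finite (vertices C n)" "vertices C n \<noteq> {}" "finite (edges C (Suc n))"
      "edges C (Suc n) \<noteq> {}"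
      using finite_vertices vertices_nonempty finite_edges edges_nonempty by (auto simp: C)
    show "src C e \<in> vertices C n" "rng C e \<in> vertices C (Suc n)"
      if "e \<in> edges C (Suc n)" for e
      using that src_in rng_in EE by (auto simp: C)
    show "\<exists>e\<in>edges C (Suc n). src C e = v" if "v \<in> vertices C n" for v
    proof -
      from that obtain w where "v = f w" "w \<in> vertices D n" by (auto simp: C)
      moreover from this obtain e where "e \<in> edges D (Suc n)" "src D e = w"
        using out_edge by blast
      ultimately show ?thesis using EE by (intro bexI[of _ "g e"]) (auto simp: C)
    qed
    show "\<exists>e\<in>edges C (Suc n). rng C e = v" if "v \<in> vertices C (Suc n)" for v
    proof -
      from that obtain w where "v = f w" "w \<in> vertices D (Suc n)" by (auto simp: C)
      moreover from this obtain e where "e \<in> edges D (Suc n)" "rng D e = w"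
        using in_edge by blast
      ultimately show ?thesis using EE by (intro bexI[of _ "g e"]) (auto simp: C)
    qed
    show "0 < label C v" if "v \<in> vertices C n" for v
      using that label_pos VV by (auto simp: C)
    show "label C v = (\<Sum>e | e \<in> edges C (Suc n) \<and> rng C e = v. label C (src C e))"
      if v: "v \<in> vertices C (Suc n)" for v
    proof -
      from v obtain w where w: "v = f w" "w \<in> vertices D (Suc n)" by (auto simp: C)
      have eq: "{e. e \<in> edges C (Suc n) \<and> rng C e = v} =
          g ` {e. e \<in> edges D (Suc n) \<and> rng D e = w}"
    proof -
      have "f (rng D e) = f w \<longleftrightarrow> rng D e = w" if "e \<in> edges D (Suc n)" for e
        using inj_on_eq_iff[OF f] VV rng_in[OF that] w(2) by blast
      then show ?thesis using w(1) EE by (auto simp: C)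
    qed
      have inj: "inj_on g {e. e \<in> edges D (Suc n) \<and> rng D e = w}"
        by (rule inj_on_subset[OF g]) (auto simp: E_def)
      have "(\<Sum>e | e \<in> edges C (Suc n) \<and> rng C e = v. label C (src C e)) =
          (\<Sum>e | e \<in> edges D (Suc n) \<and> rng D e = w. label D (src D e))"
        unfolding eq sum.reindex[OF inj] by (rule sum.cong) (auto simp: C(4)[OF EE] C(3)[OF VV[OF src_in]])
      then show ?thesis using w label_sum VV by (auto simp: C)
    qed
  qed
  with iso show ?thesis by blast
qed

end

theory Submission
  imports Defs
begin

text \<open>
  Call a diagram \<^emph>\<open>simple\<close> if every level \<open>n\<close> has a later level all of whose vertices can be
  reached from all vertices of level \<open>n\<close>.  Primitivity of a matrix is simplicity of its diagram:
  the entry \<open>(i, j)\<close> of \<open>M\<^sup>k\<close> is positive exactly if a path of length \<open>k\<close> leads from the \<open>i\<close>-th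
  to the \<open>j\<close>-th vertex, and a stationary diagram looks the same from every level
  (\<open>simple_matrix_diagram_iff\<close>).

  Simplicity survives every move in a telescope equivalence, in both directions.
  For isomorphisms this is transport of paths.  For telescopings the point is that a telescoped
  diagram has the same reachability relation between the levels that are kept
  (\<open>reach_telescope\<close>), and that full connection between two levels persists when the earlier one
  is moved further back or the later one further on: every vertex has an outgoing edge, and every
  vertex above level 0 an incoming one (\<open>fully_connected_extend\<close>).  Since the kept levels are
  cofinal, it does not matter whether a diagram is tested on all levels or on the kept ones.
\<close>

section \<open>Reachability between levels\<close>

definition edge_relation :: "('v, 'e) diagram \<Rightarrow> nat \<Rightarrow> ('v \<times> 'v) set" where
  "edge_relation D n = (\<lambda>e. (src D e, rng D e)) ` edges D (Suc n)"

text \<open>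
  The second argument of \<open>reach\<close> is the level at which paths start and the third is their length.
  Paths of length 0 are included, without reference to a vertex set, so that concatenation of
  paths is relation composition without side conditions.
\<close>

primrec reach :: "('v, 'e) diagram \<Rightarrow> nat \<Rightarrow> nat \<Rightarrow> ('v \<times> 'v) set" where
  "reach D n 0 = Id"
| "reach D n (Suc k) = reach D n k O edge_relation D (n + k)"

lemma reach_Suc_iff:
  "(v, w) \<in> reach D n (Suc k) \<longleftrightarrow>
     (\<exists>e\<in>edges D (Suc (n + k)). (v, src D e) \<in> reach D n k \<and> rng D e = w)"
  by (auto simp: edge_relation_def)

lemma reach_add: "reach D n (k + l) = reach D n k O reach D (n + k) l"
  by (induction l) (simp_all add: O_assoc add.assoc)

text \<open>
  The edges of a telescoped diagram are paths, so this identifies its one-step relation with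
  reachability in the original diagram.
\<close>

lemma reach_paths:
  "reach D n (Suc j) = (\<lambda>p. (src D (hd p), rng D (last p))) ` paths D n (n + Suc j)"
proof (induction j)
  case 0
  show ?case by (simp add: paths_Suc_0 edge_relation_def image_image)
next
  case (Suc j)
  have hd: "hd (q @ [e]) = hd q" if "q \<in> paths D n (n + Suc j)" for q e
    using paths_nonempty_list[OF that] by simp
  have P: "paths D n (n + Suc (Suc j)) = paths D n (Suc (n + Suc j))" by simp
  have "reach D n (Suc (Suc j)) =
      (\<lambda>p. (src D (hd p), rng D (last p))) ` paths D n (n + Suc j) O
        edge_relation D (n + Suc j)"
    using Suc.IH by simp
  also have "\<dots> = (\<lambda>p. (src D (hd p), rng D (last p))) ` paths D n (Suc (n + Suc j))"
    (is "?L = ?R")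
  proof (intro equalityI subsetI)
    fix x assume "x \<in> ?L"
    then obtain q e where q: "q \<in> paths D n (n + Suc j)" and e: "e \<in> edges D (Suc (n + Suc j))"
      and "rng D (last q) = src D e" and x: "x = (src D (hd q), rng D e)"
      by (auto simp: edge_relation_def simp del: add_Suc_right)
    then have "q @ [e] \<in> paths D n (Suc (n + Suc j))" by (simp only: snoc_in_paths_iff)
    then show "x \<in> ?R" by (rule rev_image_eqI) (simp add: x hd[OF q])
  next
    fix x assume "x \<in> ?R"
    then obtain q e where q: "q \<in> paths D n (n + Suc j)" and e: "e \<in> edges D (Suc (n + Suc j))"
      and "rng D (last q) = src D e" and "x = (src D (hd (q @ [e])), rng D (last (q @ [e])))"
      unfolding paths_Suc by auto
    then show "x \<in> ?L"
      unfolding edge_relation_def hd[OF q] by force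
  qed
  finally show ?case unfolding P .
qed

lemma edge_relation_telescope:
  assumes "strict_mono m"
  shows "edge_relation (telescope m D) n = reach D (m n) (m (Suc n) - m n)"
proof -
  obtain j where j: "m (Suc n) = m n + Suc j"
    using strict_monoD[OF assms, of n "Suc n"] less_imp_Suc_add by fastforce
  have "edge_relation (telescope m D) n =
      (\<lambda>p. (src D (hd p), rng D (last p))) ` paths D (m n) (m n + Suc j)"
    by (simp add: edge_relation_def telescope_def j)
  also have "\<dots> = reach D (m n) (Suc j)" by (rule reach_paths[symmetric])
  finally show ?thesis by (simp add: j)
qed

lemma reach_telescope:
  assumes "strict_mono m"
  shows "reach (telescope m D) n k = reach D (m n) (m (n + k) - m n)"
proof (induction k)
  case (Suc k)
  have le: "m n \<le> m (n + k)" "m (n + k) \<le> m (Suc (n + k))"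
    using assms by (simp_all add: strict_mono_less_eq)
  have "reach (telescope m D) n (Suc k) =
      reach D (m n) (m (n + k) - m n) O reach D (m (n + k)) (m (Suc (n + k)) - m (n + k))"
    by (simp add: Suc.IH edge_relation_telescope[OF assms])
  also have "\<dots> = reach D (m n) ((m (n + k) - m n) + (m (Suc (n + k)) - m (n + k)))"
    unfolding reach_add using le by simp
  finally show ?case using le by simp
qed simp

section \<open>Fully connected levels and simple diagrams\<close>

definition fully_connected :: "('v, 'e) diagram \<Rightarrow> nat \<Rightarrow> nat \<Rightarrow> bool" where
  "fully_connected D n k \<longleftrightarrow> vertices D n \<times> vertices D (n + k) \<subseteq> reach D n k"

text \<open>
  Length 0 is excluded: a level with a single vertex is trivially connected to itself, which
  matches a zeroth matrix power and would say nothing about the edges.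
\<close>

definition simple_diagram :: "('v, 'e) diagram \<Rightarrow> bool" where
  "simple_diagram D \<longleftrightarrow> (\<forall>n. \<exists>k\<ge>1. fully_connected D n k)"

lemma (in bratteli_diagram) reach_forward:
  assumes "v \<in> vertices D n"
  shows "\<exists>w\<in>vertices D (n + k). (v, w) \<in> reach D n k"
proof (induction k)
  case (Suc k)
  then obtain w where "w \<in> vertices D (n + k)" "(v, w) \<in> reach D n k" by blast
  moreover from this obtain e where "e \<in> edges D (Suc (n + k))" "src D e = w"
    using out_edge by blast
  ultimately show ?case
    using rng_in[of e "n + k"] by (intro bexI[of _ "rng D e"]) (auto simp: edge_relation_def)
qed (use assms in simp)

lemma (in bratteli_diagram) reach_backward:
  assumes "w \<in> vertices D (n + k)"
  shows "\<exists>v\<in>vertices D n. (v, w) \<in> reach D n k"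
  using assms
proof (induction k arbitrary: w)
  case (Suc k)
  then obtain e where e: "e \<in> edges D (Suc (n + k))" "rng D e = w"
    using in_edge[of w "n + k"] by auto
  then obtain v where "v \<in> vertices D n" "(v, src D e) \<in> reach D n k"
    using Suc.IH src_in by blast
  then show ?case using e by (auto simp: edge_relation_def)
qed simp

lemma (in bratteli_diagram) fully_connected_extend:
  assumes "fully_connected D (n + a) k"
  shows "fully_connected D n (a + k + b)"
  unfolding fully_connected_def
proof clarify
  fix u x assume "u \<in> vertices D n" "x \<in> vertices D (n + (a + k + b))"
  then obtain v w where "v \<in> vertices D (n + a)" "(u, v) \<in> reach D n a"
    and "w \<in> vertices D (n + a + k)" "(w, x) \<in> reach D (n + a + k) b"
    using reach_forward[of u n a] reach_backward[of x "n + a + k" b] by (auto simp: add.assoc)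
  moreover from this have "(v, w) \<in> reach D (n + a) k"
    using assms by (auto simp: fully_connected_def)
  ultimately show "(u, x) \<in> reach D n (a + k + b)"
    by (auto simp: reach_add add.assoc)
qed

lemma fully_connected_telescope:
  assumes "strict_mono m"
  shows "fully_connected (telescope m D) n k \<longleftrightarrow> fully_connected D (m n) (m (n + k) - m n)"
proof -
  have "m n \<le> m (n + k)" using assms by (simp add: strict_mono_less_eq)
  then show ?thesis
    unfolding fully_connected_def reach_telescope[OF assms] by (simp add: telescope_def)
qed

lemma (in bratteli_diagram) simple_telescope_iff:
  assumes m: "strict_mono m"
  shows "simple_diagram (telescope m D) \<longleftrightarrow> simple_diagram D"
proof
  assume simple: "simple_diagram D"
  show "simple_diagram (telescope m D)"
    unfolding simple_diagram_def
  proof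
    fix n
    obtain k where k: "k \<ge> 1" "fully_connected D (m n) k"
      using simple by (auto simp: simple_diagram_def)
    \<comment> \<open>A strictly increasing sequence gains at least 1 per step, so \<open>k\<close> steps are enough.\<close>
    have "m n + k \<le> m (n + k)"
    proof (induction k)
      case (Suc k)
      then show ?case using strict_monoD[OF m, of "n + k" "n + Suc k"] by simp
    qed simp
    then have "m (n + k) - m n = 0 + k + (m (n + k) - m n - k)" by simp
    then have "fully_connected (telescope m D) n k"
      using k(2) fully_connected_extend[of "m n" 0 k]
      unfolding fully_connected_telescope[OF m] by (metis add_0_right)
    with k(1) show "\<exists>k\<ge>1. fully_connected (telescope m D) n k" by blast
  qed
next
  assume simple: "simple_diagram (telescope m D)"
  show "simple_diagram D"
    unfolding simple_diagram_def
  proof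
    fix n
    obtain k where k: "k \<ge> 1" "fully_connected D (m n) (m (n + k) - m n)"
      using simple by (auto simp: simple_diagram_def fully_connected_telescope[OF m])
    \<comment> \<open>Go from level \<open>n\<close> up to the kept level \<open>m n\<close>, and use the connection of kept levels there.\<close>
    have le: "n + (m n - n) = m n" using strict_mono_imp_increasing[OF m] by simp
    then have "fully_connected D n ((m n - n) + (m (n + k) - m n) + 0)"
      using k(2) by (intro fully_connected_extend) simp
    moreover have "m n < m (n + k)" using strict_monoD[OF m] k(1) by simp
    ultimately show "\<exists>k\<ge>1. fully_connected D n k"
      by (intro exI[of _ "(m n - n) + (m (n + k) - m n) + 0"]) simp
  qed
qed

section \<open>Invariance under telescope equivalence\<close>

text \<open>
  An isomorphic copy of a Bratteli diagram need not be one itself: the vertex bijection is only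
  level-wise, so distinct levels of the copy may overlap.  What the copy inherits, and what the
  transport of paths uses, is that edges run between consecutive levels.
\<close>

definition graded :: "('v, 'e) diagram \<Rightarrow> bool" where
  "graded D \<longleftrightarrow> (\<forall>n. \<forall>e\<in>edges D (Suc n). src D e \<in> vertices D n \<and> rng D e \<in> vertices D (Suc n))"

lemma (in bratteli_diagram) graded: "graded D"
  by (simp add: graded_def src_in rng_in)

lemma graded_isomorphic:
  assumes "graded D" "isomorphic D D'"
  shows "graded D'"
proof -
  obtain f g where f: "\<And>n. bij_betw f (vertices D n) (vertices D' n)"
    and g: "\<And>n. bij_betw g (edges D (Suc n)) (edges D' (Suc n))"
    and fg: "\<And>n e. e \<in> edges D (Suc n) \<Longrightarrow> src D' (g e) = f (src D e) \<and> rng D' (g e) = f (rng D e)"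
    using assms(2) unfolding isomorphic_def by blast
  show ?thesis
    unfolding graded_def
  proof (intro allI ballI)
    fix n e' assume "e' \<in> edges D' (Suc n)"
    then obtain e where "e \<in> edges D (Suc n)" "e' = g e"
      using g[of n] by (auto simp: bij_betw_def)
    then show "src D' e' \<in> vertices D' n \<and> rng D' e' \<in> vertices D' (Suc n)"
      using assms(1) fg bij_betwE[OF f] by (simp add: graded_def)
  qed
qed

lemma simple_isomorphic_iff:
  assumes "graded D" "isomorphic D D'"
  shows "simple_diagram D' \<longleftrightarrow> simple_diagram D"
proof -
  obtain f g where f: "\<And>n. bij_betw f (vertices D n) (vertices D' n)"
    and g: "\<And>n. bij_betw g (edges D (Suc n)) (edges D' (Suc n))"
    and fg: "\<And>n e. e \<in> edges D (Suc n) \<Longrightarrow> src D' (g e) = f (src D e) \<and> rng D' (g e) = f (rng D e)"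
    using assms(2) unfolding isomorphic_def by blast
  have inj: "f v = f w \<longleftrightarrow> v = w" if "v \<in> vertices D n" "w \<in> vertices D n" for v w n
    using f[of n] that by (auto simp: bij_betw_def inj_on_eq_iff)
  have verts: "src D e \<in> vertices D n" "rng D e \<in> vertices D (Suc n)"
    if "e \<in> edges D (Suc n)" for e n
    using assms(1) that by (auto simp: graded_def)
  have reach: "(f v, f w) \<in> reach D' n k \<longleftrightarrow> (v, w) \<in> reach D n k"
    if "v \<in> vertices D n" "w \<in> vertices D (n + k)" for v w n k
    using that(2)
  proof (induction k arbitrary: w)
    case 0
    then show ?case using inj that(1) by simp
  next
    case (Suc k)
    have E: "edges D' (Suc (n + k)) = g ` edges D (Suc (n + k))"
      using g[of "n + k"] by (simp add: bij_betw_def)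
    have "(f v, f w) \<in> reach D' n (Suc k) \<longleftrightarrow>
        (\<exists>e\<in>edges D (Suc (n + k)). (f v, f (src D e)) \<in> reach D' n k \<and> f (rng D e) = f w)"
      unfolding reach_Suc_iff E using fg by simp
    also have "\<dots> \<longleftrightarrow> (\<exists>e\<in>edges D (Suc (n + k)). (v, src D e) \<in> reach D n k \<and> rng D e = w)"
    proof (rule bex_cong[OF refl])
      fix e assume e: "e \<in> edges D (Suc (n + k))"
      then have "f (rng D e) = f w \<longleftrightarrow> rng D e = w"
        using verts(2) Suc.prems by (intro inj[of _ "Suc (n + k)"]) simp_all
      then show "(f v, f (src D e)) \<in> reach D' n k \<and> f (rng D e) = f w \<longleftrightarrow>
          (v, src D e) \<in> reach D n k \<and> rng D e = w"
        using Suc.IH[OF verts(1)[OF e]] by simp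
    qed
    also have "\<dots> \<longleftrightarrow> (v, w) \<in> reach D n (Suc k)"
      by (rule reach_Suc_iff[symmetric])
    finally show ?case .
  qed
  have V: "vertices D' n = f ` vertices D n" for n
    using f[of n] by (simp add: bij_betw_def)
  have "fully_connected D' n k \<longleftrightarrow> fully_connected D n k" for n k
  proof -
    have "f ` vertices D n \<times> f ` vertices D (n + k) \<subseteq> R \<longleftrightarrow>
        (\<forall>v\<in>vertices D n. \<forall>w\<in>vertices D (n + k). (f v, f w) \<in> R)" for R
      by blast
    moreover have "vertices D n \<times> vertices D (n + k) \<subseteq> R \<longleftrightarrow>
        (\<forall>v\<in>vertices D n. \<forall>w\<in>vertices D (n + k). (v, w) \<in> R)" for R
      by blast
    ultimately show ?thesis
      unfolding fully_connected_def V using reach by simp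
  qed
  then show ?thesis by (simp add: simple_diagram_def)
qed

lemma simple_is_telescoping_iff:
  assumes "bratteli_diagram D" "is_telescoping D D'"
  shows "simple_diagram D' \<longleftrightarrow> simple_diagram D"
proof -
  interpret bratteli_diagram D by fact
  obtain m where m: "strict_mono m" "isomorphic (telescope m D) D'"
    using assms(2) by (auto simp: is_telescoping_def)
  then have "simple_diagram D' \<longleftrightarrow> simple_diagram (telescope m D)"
    by (intro simple_isomorphic_iff bratteli_diagram.graded bratteli_diagram_telescope)
  then show ?thesis using simple_telescope_iff[OF m(1)] by simp
qed

lemma simple_telescope_step_iff:
  assumes "telescope_step D D'"
  shows "simple_diagram D' \<longleftrightarrow> simple_diagram D"
proof -
  have D: "bratteli_diagram D" "bratteli_diagram D'"
    and "isomorphic D D' \<or> is_telescoping D D' \<or> is_telescoping D' D"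
    using assms by (simp_all add: telescope_step_def)
  from this(3) show ?thesis
    using simple_isomorphic_iff[OF bratteli_diagram.graded[OF D(1)]]
      simple_is_telescoping_iff[OF D(1)] simple_is_telescoping_iff[OF D(2)] by blast
qed

lemma simple_telescope_equivalent_iff:
  assumes "telescope_equivalent D D'"
  shows "simple_diagram D' \<longleftrightarrow> simple_diagram D"
proof -
  obtain C C' where D: "bratteli_diagram D" and C: "isomorphic D C"
    and steps: "telescope_step\<^sup>*\<^sup>* C C'" and C': "isomorphic C' D'"
    using assms by (auto simp: telescope_equivalent_def)
  have "graded C" using bratteli_diagram.graded[OF D] C by (rule graded_isomorphic)
  \<comment> \<open>Gradedness is carried along because a chain without steps does not make \<open>C'\<close> Bratteli.\<close>
  from steps this have "graded C' \<and> (simple_diagram C' \<longleftrightarrow> simple_diagram C)"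
  proof induction
    case (step y z)
    then have "graded z" using bratteli_diagram.graded by (auto simp: telescope_step_def)
    then show ?case using step simple_telescope_step_iff by blast
  qed simp
  then show ?thesis
    using simple_isomorphic_iff[OF _ C'] simple_isomorphic_iff[OF bratteli_diagram.graded[OF D] C]
    by blast
qed

section \<open>Primitive matrices\<close>

lemma reach_matrix_diagram_iff:
  assumes M: "M \<in> carrier_mat d d" and "i < d" "j < d"
  shows "((n, i), (n + k, j)) \<in> reach (matrix_diagram M) n k \<longleftrightarrow> 0 < (M ^\<^sub>m k) $$ (i, j)"
  using \<open>j < d\<close>
proof (induction k arbitrary: j)
  case 0
  then show ?case using assms(1,2) by auto
next
  case (Suc k)
  have [simp]: "dim_row M = d" "dim_col M = d" using M by auto
  have P: "M ^\<^sub>m k \<in> carrier_mat d d" using M by (rule pow_carrier_mat)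
  have "((n, i), (n + Suc k, j)) \<in> reach (matrix_diagram M) n (Suc k) \<longleftrightarrow>
      (\<exists>l<d. ((n, i), (n + k, l)) \<in> reach (matrix_diagram M) n k \<and> 0 < M $$ (l, j))"
  proof -
    let ?D = "matrix_diagram M"
    have "((n, i), (n + Suc k, j)) \<in> reach ?D n (Suc k) \<longleftrightarrow>
        (\<exists>e\<in>edges ?D (Suc (n + k)). ((n, i), src ?D e) \<in> reach ?D n k \<and>
          rng ?D e = (n + Suc k, j))"
      by (rule reach_Suc_iff)
    also have "\<dots> \<longleftrightarrow> (\<exists>l<d. \<exists>c<M $$ (l, j).
        ((n, i), src ?D (Suc (n + k), l, j, c)) \<in> reach ?D n k)"
      using Suc.prems by (fastforce simp: matrix_diagram_def)
    also have "\<dots> \<longleftrightarrow> (\<exists>l<d. ((n, i), (n + k, l)) \<in> reach ?D n k \<and> 0 < M $$ (l, j))"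
      by (auto simp: matrix_diagram_def)
    finally show ?thesis .
  qed
  also have "\<dots> \<longleftrightarrow> (\<exists>l<d. 0 < (M ^\<^sub>m k) $$ (i, l) \<and> 0 < M $$ (l, j))"
    using Suc.IH by auto
  also have "\<dots> \<longleftrightarrow> 0 < (\<Sum>l<d. (M ^\<^sub>m k) $$ (i, l) * M $$ (l, j))"
    unfolding zero_less_iff_neq_zero by (auto simp del: neq0_conv)
  also have "(\<Sum>l<d. (M ^\<^sub>m k) $$ (i, l) * M $$ (l, j)) = (M ^\<^sub>m Suc k) $$ (i, j)"
    using P assms(2) Suc.prems by (simp add: scalar_prod_def atLeast0LessThan)
  finally show ?case .
qed

lemma simple_matrix_diagram_iff:
  assumes M: "M \<in> carrier_mat d d"
  shows "simple_diagram (matrix_diagram M) \<longleftrightarrow> primitive_mat M"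
proof -
  have V: "vertices (matrix_diagram M) n = Pair n ` {..<d}" for n
    using M by (auto simp: matrix_diagram_def)
  have "fully_connected (matrix_diagram M) n k \<longleftrightarrow> (\<forall>i<d. \<forall>j<d. 0 < (M ^\<^sub>m k) $$ (i, j))"
    for n k
  proof -
    have "Pair n ` {..<d} \<times> Pair (n + k) ` {..<d} \<subseteq> R \<longleftrightarrow>
        (\<forall>i<d. \<forall>j<d. ((n, i), (n + k, j)) \<in> R)" for R
      by (simp add: subset_iff image_iff) blast
    then show ?thesis
      using V reach_matrix_diagram_iff[OF M] by (simp add: fully_connected_def)
  qed
  then show ?thesis
    using M by (simp add: simple_diagram_def primitive_mat_def)
qed

theorem proposition4p4:
  fixes A :: "'a list" and \<sigma> :: "'a \<Rightarrow> 'a list"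
    and B :: "'b list" and \<tau> :: "'b \<Rightarrow> 'b list"
    and M N :: "nat mat"
  assumes "symbolic_substitution A \<sigma>" and "M = substitution_matrix A \<sigma>"
    and "symbolic_substitution B \<tau>" and "N = substitution_matrix B \<tau>"
    and "primitive_mat M"
    and "telescope_equivalent (matrix_diagram N) (matrix_diagram M)"
  shows "primitive_mat N"
proof -
  have M: "M \<in> carrier_mat (length A) (length A)" and N: "N \<in> carrier_mat (length B) (length B)"
    using assms(2,4) by (simp_all add: substitution_matrix_def)
  have "simple_diagram (matrix_diagram M)"
    using assms(5) simple_matrix_diagram_iff[OF M] by simp
  then have "simple_diagram (matrix_diagram N)"
    using simple_telescope_equivalent_iff[OF assms(6)] by simp
  then show ?thesis using simple_matrix_diagram_iff[OF N] by simp
qed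

end
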